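(* Let $\Phi=(\phi_j)_{j=1}^n$ be an $(a,b)$-equiangular system (with $a,b\in\mathbb{F}_0$) which is also a frame for a non-isotropic $d$-dimensional space $V$, and suppose $\operatorname{Char}\mathbb{F}\nmid d$ and $\frac{na}{d}\neq 0$ in $\mathbb{F}$. Then $\Phi$ is an $(a,b,\frac{n}{d}a)$-equiangular tight frame for $V$ if and only if $(n-1)b=\frac{n-d}{d}a^2$ and $\sum_{\ell=1}^n\Delta(\phi_j,\phi_k,\phi_\ell)=\frac{nab}{d}$ for all $j\neq k$ in $[n]$.
   Context: $\mathbb{F}$ is a field with an involution $\sigma$ (possibly the identity), $\mathbb{F}_0=\{x: x^\sigma=x\}$. A non-isotropic space is a finite-dimensional $\mathbb{F}$-vector space with a non-degenerate Hermitian scalar product $\langle\cdot,\cdot\rangle$ (linear in the second argument, $\langle u,v\rangle=\langle v,u\rangle^\sigma$, and $\langle u,w\rangle=0$ for all $w$ implies $u=0$). $\mathbb{F}^n$ carries $\langle x,y\rangle=\sum_i x_i^\sigma y_i$. For $\Phi=(\phi_j)_{j=1}^n$ in $V$, the synthesis operator is $\Phi:\mathbb{F}^n\to V$, $x\mapsto\sum_jx_j\phi_j$, with adjoint $\Phi^\dagger v=(\langle\phi_j,v\rangle)_j$. $\Phi$ is a frame for $V$ if its vectors span $V$, and a $c$-tight frame if moreover $\Phi\Phi^\dagger=cI$. $\Phi$ is $(a,b)$-equiangular if $\langle\phi_j,\phi_j\rangle=a$ for all $j$ and $\langle\phi_j,\phi_k\rangle\langle\phi_k,\phi_j\rangle=b$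 for $j\neq k$; an $(a,b,c)$-equiangular tight frame for $V$ is an $(a,b)$-equiangular system which is a $c$-tight frame for $V$. $\Delta(\phi_j,\phi_k,\phi_\ell)=\langle\phi_j,\phi_k\rangle\langle\phi_k,\phi_\ell\rangle\langle\phi_\ell,\phi_j\rangle$. Integers and fractions of integers are interpreted in $\mathbb{F}$ via $\mathbb{Z}\to\mathbb{F}$. *)

theory Defs
  imports "HOL-Analysis.Analysis"
begin

locale field_involution =
  fixes \<sigma> :: "'f::field \<Rightarrow> 'f"
  assumes inv_add: "\<sigma> (x + y) = \<sigma> x + \<sigma> y"
    and inv_mult: "\<sigma> (x * y) = \<sigma> x * \<sigma> y"
    and inv_one: "\<sigma> 1 = 1"
    and inv_inv: "\<sigma> (\<sigma> x) = x"

definition fixed_field :: "('f::field \<Rightarrow> 'f) \<Rightarrow> 'f set" where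
  "fixed_field \<sigma> = {x. \<sigma> x = x}"

text \<open>The space \<open>V\<close> is the whole type \<open>'v\<close>; it is a vector space over \<open>'f\<close> via \<open>smul\<close>.\<close>

locale non_isotropic_space =
  vector_space smul + field_involution \<sigma>
  for smul :: "'f::field \<Rightarrow> 'v::ab_group_add \<Rightarrow> 'v" and \<sigma> :: "'f \<Rightarrow> 'f" +
  fixes form :: "'v \<Rightarrow> 'v \<Rightarrow> 'f"
  assumes finite_dimensional: "\<exists>B. finite B \<and> span B = UNIV"
    and form_add_right: "form u (v + w) = form u v + form u w"
    and form_scale_right: "form u (smul c v) = c * form u v"
    and form_hermitian: "form u v = \<sigma> (form v u)"
    and form_nondegenerate: "(\<And>w. form u w = 0) \<Longrightarrow> u = 0"

definition std_form :: "('f::field \<Rightarrow> 'f) \<Rightarrow> 'f ^ 'n \<Rightarrow> 'f ^ 'n \<Rightarrow> 'f" where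
  "std_form \<sigma> x y = (\<Sum>i\<in>UNIV. \<sigma> (x $ i) * y $ i)"

text \<open>A system \<open>(\<phi>\<^sub>j)\<close> of \<open>n\<close> vectors is a family indexed by a finite type \<open>'n\<close> with \<open>n = CARD('n)\<close>.\<close>

definition synthesis ::
  "('f::field \<Rightarrow> 'v::ab_group_add \<Rightarrow> 'v) \<Rightarrow> ('n::finite \<Rightarrow> 'v) \<Rightarrow> 'f ^ 'n \<Rightarrow> 'v" where
  "synthesis smul \<phi> x = (\<Sum>j\<in>UNIV. smul (x $ j) (\<phi> j))"

definition analysis :: "('v \<Rightarrow> 'v \<Rightarrow> 'f::field) \<Rightarrow> ('n::finite \<Rightarrow> 'v) \<Rightarrow> 'v \<Rightarrow> 'f ^ 'n" where
  "analysis form \<phi> v = (\<chi> j. form (\<phi> j) v)"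

definition is_frame ::
  "('f::field \<Rightarrow> 'v::ab_group_add \<Rightarrow> 'v) \<Rightarrow> ('n::finite \<Rightarrow> 'v) \<Rightarrow> bool" where
  "is_frame smul \<phi> \<longleftrightarrow> module.span smul (range \<phi>) = UNIV"

definition is_tight_frame ::
  "('f::field \<Rightarrow> 'v::ab_group_add \<Rightarrow> 'v) \<Rightarrow> ('v \<Rightarrow> 'v \<Rightarrow> 'f) \<Rightarrow> 'f \<Rightarrow> ('n::finite \<Rightarrow> 'v) \<Rightarrow> bool"
  where
  "is_tight_frame smul form c \<phi> \<longleftrightarrow>
     is_frame smul \<phi> \<and> synthesis smul \<phi> \<circ> analysis form \<phi> = (\<lambda>v. smul c v)"

definition equiangular :: "('v \<Rightarrow> 'v \<Rightarrow> 'f::field) \<Rightarrow> 'f \<Rightarrow> 'f \<Rightarrow> ('n::finite \<Rightarrow> 'v) \<Rightarrow> bool" where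
  "equiangular form a b \<phi> \<longleftrightarrow>
     (\<forall>j. form (\<phi> j) (\<phi> j) = a) \<and>
     (\<forall>j k. j \<noteq> k \<longrightarrow> form (\<phi> j) (\<phi> k) * form (\<phi> k) (\<phi> j) = b)"

definition equiangular_tight_frame ::
  "('f::field \<Rightarrow> 'v::ab_group_add \<Rightarrow> 'v) \<Rightarrow> ('v \<Rightarrow> 'v \<Rightarrow> 'f) \<Rightarrow> 'f \<Rightarrow> 'f \<Rightarrow> 'f
     \<Rightarrow> ('n::finite \<Rightarrow> 'v) \<Rightarrow> bool" where
  "equiangular_tight_frame smul form a b c \<phi> \<longleftrightarrow>
     equiangular form a b \<phi> \<and> is_tight_frame smul form c \<phi>"

definition triple_product :: "('v \<Rightarrow> 'v \<Rightarrow> 'f::field) \<Rightarrow> 'v \<Rightarrow> 'v \<Rightarrow> 'v \<Rightarrow> 'f" where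
  "triple_product form u v w = form u v * form v w * form w u"

text \<open>\<open>analysis form \<phi>\<close> is the adjoint \<open>\<Phi>\<^sup>\<dagger>\<close> of the synthesis operator.\<close>

lemma (in non_isotropic_space) synthesis_adjoint:
  "form (synthesis smul \<phi> x) v = std_form \<sigma> x (analysis form \<phi> v)"
proof -
  have r0: "form u 0 = 0" for u
    using form_add_right[of u 0 0] by (metis add.right_neutral add_left_cancel)
  have rs: "form v (\<Sum>j\<in>A. g j) = (\<Sum>j\<in>A. form v (g j))" if "finite A" for A :: "'n set" and g
    using that by (induction A) (simp_all add: r0 form_add_right)
  have s0: "\<sigma> 0 = 0"
    using inv_add[of 0 0] by (metis add.right_neutral add_left_cancel)
  have ss: "\<sigma> (\<Sum>j\<in>A. h j) = (\<Sum>j\<in>A. \<sigma> (h j))" if "finite A" for A :: "'n set" and h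
    using that by (induction A) (simp_all add: s0 inv_add)
  have "form (synthesis smul \<phi> x) v = \<sigma> (form v (synthesis smul \<phi> x))"
    by (rule form_hermitian)
  also have "\<dots> = (\<Sum>j\<in>UNIV. \<sigma> (x $ j * form v (\<phi> j)))"
    by (simp add: synthesis_def rs ss form_scale_right)
  also have "\<dots> = (\<Sum>j\<in>UNIV. \<sigma> (x $ j) * form (\<phi> j) v)"
    by (intro sum.cong refl) (simp add: inv_mult form_hermitian[of "\<phi> _" v])
  finally show ?thesis
    by (simp add: std_form_def analysis_def)
qed

end

theory Submission
  imports Defs
begin

text \<open>
  Let \<open>G\<close> be the Gram matrix and \<open>c = n a / d\<close>. Since the vectors span and the form is
  non-degenerate, \<open>\<Phi>\<Phi>\<^sup>\<dagger> = c I\<close> is equivalent to \<open>G\<^sup>2 = c G\<close>. The diagonal entries of this matrix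
  equation give the relation between \<open>a\<close> and \<open>b\<close>; the entry \<open>(k, j)\<close> multiplied by \<open>G\<^sub>j\<^sub>k\<close> gives the
  triple product condition. The factor can be cancelled when \<open>b \<noteq> 0\<close>, and when \<open>b = 0\<close> the
  matrix \<open>G\<close> is diagonal because \<open>G\<^sub>k\<^sub>j = \<sigma> G\<^sub>j\<^sub>k\<close>.
\<close>

context non_isotropic_space
begin

lemma inv_zero: "\<sigma> 0 = 0"
  using inv_add[of 0 0] by (metis add.right_neutral add_left_cancel)

lemma form_zero_right: "form u 0 = 0"
  using form_add_right[of u 0 0] by (metis add.right_neutral add_left_cancel)

lemma form_diff_right: "form u (v - w) = form u v - form u w"
  using form_add_right[of u "v - w" w] by (simp add: algebra_simps)

lemma form_sum_right: "finite A \<Longrightarrow> form u (\<Sum>j\<in>A. g j) = (\<Sum>j\<in>A. form u (g j))"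
  by (induction A rule: finite_induct) (simp_all add: form_zero_right form_add_right)

lemma form_eq_0_commute: "form u v = 0 \<longleftrightarrow> form v u = 0"
  by (metis form_hermitian inv_zero)

text \<open>Linearity sits in the right argument, so the vectors \<open>u\<close> with
  \<open>form w u = 0\<close> form a subspace. It contains the spanning family, so non-degeneracy
  applies to \<open>w\<close>.\<close>

lemma eq_0_if_orthogonal_frame:
  assumes "is_frame smul \<phi>" and orth: "\<And>j. form (\<phi> j) w = 0"
  shows "w = 0"
proof (rule form_nondegenerate)
  fix u
  have "u \<in> span (range \<phi>)"
    using assms(1) by (simp add: is_frame_def)
  then show "form w u = 0"
  proof (induction rule: span_induct)
    case base
    show ?case
      by (auto simp: subspace_def form_zero_right form_add_right form_scale_right)
  next
    case (step x)
    then show ?case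
      using orth form_eq_0_commute by auto
  qed
qed

lemma frame_operator_eq:
  "(synthesis smul \<phi> \<circ> analysis form \<phi>) v = (\<Sum>l\<in>UNIV. smul (form (\<phi> l) v) (\<phi> l))"
  by (simp add: synthesis_def analysis_def)

text \<open>For frame vectors \<open>u\<close> and \<open>v\<close> this is an entry of the square
  of the Gram matrix.\<close>

lemma form_frame_operator:
  "form u ((synthesis smul \<phi> \<circ> analysis form \<phi>) v) = (\<Sum>l\<in>UNIV. form u (\<phi> l) * form (\<phi> l) v)"
  by (simp only: frame_operator_eq form_sum_right[OF finite] form_scale_right mult.commute)

lemma is_tight_frame_iff_gram:
  assumes frame: "is_frame smul \<phi>"
  shows "is_tight_frame smul form c \<phi> \<longleftrightarrow>
    (\<forall>j k. (\<Sum>l\<in>UNIV. form (\<phi> j) (\<phi> l) * form (\<phi> l) (\<phi> k)) = c * form (\<phi> j) (\<phi> k))"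
    (is "_ \<longleftrightarrow> ?gram")
proof
  assume "is_tight_frame smul form c \<phi>"
  then have S: "synthesis smul \<phi> \<circ> analysis form \<phi> = smul c"
    by (simp add: is_tight_frame_def)
  show ?gram
    using form_frame_operator[of _ \<phi>] unfolding S by (simp add: form_scale_right)
next
  assume gram: ?gram
  let ?S = "synthesis smul \<phi> \<circ> analysis form \<phi>"
  have "?S v = smul c v" for v
  proof -
    have "v \<in> span (range \<phi>)"
      using frame by (simp add: is_frame_def)
    then show ?thesis
    proof (induction rule: span_induct)
      case base
      \<comment> \<open>Both operators are linear, so the vectors on which they agree form a
        subspace; only the frame vectors remain to be checked.\<close>
      have "?S (x + y) = ?S x + ?S y" "?S (smul r x) = smul r (?S x)" "?S 0 = 0" for r x y
        unfolding frame_operator_eq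
        by (simp_all add: form_add_right form_scale_right form_zero_right scale_left_distrib
            sum.distrib scale_sum_right)
      then show ?case
        by (simp add: subspace_def scale_right_distrib scale_left_commute del: o_apply)
    next
      case (step x)
      then obtain k where x: "x = \<phi> k"
        by blast
      \<comment> \<open>This is entry \<open>(j, k)\<close> of the Gram identity.\<close>
      have "form (\<phi> j) (?S x - smul c x) = 0" for j
        using gram
        by (simp add: x form_diff_right form_frame_operator form_scale_right del: o_apply)
      then have "?S x - smul c x = 0"
        by (rule eq_0_if_orthogonal_frame[OF frame])
      then show ?case
        by simp
    qed
  qed
  then show "is_tight_frame smul form c \<phi>"
    using frame by (auto simp: is_tight_frame_def)
qed

lemma equiangular_gram_square_diagonal:
  fixes \<phi> :: "'n::finite \<Rightarrow> 'v"
  assumes "equiangular form a b \<phi>"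
  shows "(\<Sum>l\<in>UNIV. form (\<phi> j) (\<phi> l) * form (\<phi> l) (\<phi> j)) = a\<^sup>2 + (of_nat CARD('n) - 1) * b"
proof -
  have "(\<Sum>l\<in>UNIV. form (\<phi> j) (\<phi> l) * form (\<phi> l) (\<phi> j))
      = a\<^sup>2 + (\<Sum>l\<in>UNIV - {j}. form (\<phi> j) (\<phi> l) * form (\<phi> l) (\<phi> j))"
    using assms by (subst sum.remove[of _ j]) (auto simp: equiangular_def power2_eq_square)
  also have "(\<Sum>l\<in>UNIV - {j}. form (\<phi> j) (\<phi> l) * form (\<phi> l) (\<phi> j)) = (\<Sum>l\<in>UNIV - {j}. b)"
    using assms by (intro sum.cong) (auto simp: equiangular_def)
  also have "\<dots> = (of_nat CARD('n) - 1) * b"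
    \<comment> \<open>The index type is nonempty, so the natural number \<open>CARD('n) - 1\<close>
      is not truncated and its cast is the difference in the field.\<close>
    by (simp add: of_nat_diff Suc_leI)
  finally show ?thesis .
qed

text \<open>The factor \<open>form u v\<close> does not depend on the summation index; over all
  indices, the remaining sum for frame vectors is an entry of the squared Gram matrix, with the
  indices swapped.\<close>

lemma sum_triple_product:
  "(\<Sum>l\<in>A. triple_product form u v (\<phi> l)) = form u v * (\<Sum>l\<in>A. form v (\<phi> l) * form (\<phi> l) u)"
  by (simp add: triple_product_def sum_distrib_left mult.assoc)

lemma equiangular_tight_frame_iff_triple_products:
  fixes \<phi> :: "'n::finite \<Rightarrow> 'v"
  assumes equi: "equiangular form a b \<phi>" and frame: "is_frame smul \<phi>"
  shows "equiangular_tight_frame smul form a b c \<phi> \<longleftrightarrow>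
    a\<^sup>2 + (of_nat CARD('n) - 1) * b = c * a \<and>
    (\<forall>j k. j \<noteq> k \<longrightarrow> (\<Sum>l\<in>UNIV. triple_product form (\<phi> j) (\<phi> k) (\<phi> l)) = c * b)"
    (is "_ \<longleftrightarrow> ?diag \<and> ?triple")
proof -
  let ?G2 = "\<lambda>j k. \<Sum>l\<in>UNIV. form (\<phi> j) (\<phi> l) * form (\<phi> l) (\<phi> k)"
  have a: "form (\<phi> j) (\<phi> j) = a" for j
    using equi by (simp add: equiangular_def)
  have b: "form (\<phi> j) (\<phi> k) * form (\<phi> k) (\<phi> j) = b" if "j \<noteq> k" for j k
    using equi that by (simp add: equiangular_def)
  have diag: "?G2 j j = c * form (\<phi> j) (\<phi> j) \<longleftrightarrow> ?diag" for j
    using equiangular_gram_square_diagonal[OF equi] by (simp add: a)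
  have off: "?G2 k j = c * form (\<phi> k) (\<phi> j) \<longleftrightarrow>
      (\<Sum>l\<in>UNIV. triple_product form (\<phi> j) (\<phi> k) (\<phi> l)) = c * b" if "j \<noteq> k" for j k
  proof (cases "b = 0")
    case True
    then have orth: "form (\<phi> i) (\<phi> m) = 0" if "i \<noteq> m" for i m
      using b[OF that] form_eq_0_commute by auto
    \<comment> \<open>As \<open>j\<close> and \<open>k\<close> differ, \<open>l\<close> differs from
      one of them, so one factor is off-diagonal.\<close>
    have "form (\<phi> k) (\<phi> l) * form (\<phi> l) (\<phi> j) = 0" for l
      using orth \<open>j \<noteq> k\<close> by (cases "l = k") auto
    then have "?G2 k j = 0"
      by (intro sum.neutral) blast
    then show ?thesis
      using True orth that by (simp add: sum_triple_product)
  next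
    case False
    then have nz: "form (\<phi> j) (\<phi> k) \<noteq> 0"
      using b[OF that] by auto
    \<comment> \<open>Splitting \<open>b\<close> exposes the same nonzero factor on both sides of
      the triple product condition.\<close>
    have cb: "c * b = form (\<phi> j) (\<phi> k) * (c * form (\<phi> k) (\<phi> j))"
      using b[OF that] by (simp add: mult_ac)
    show ?thesis
      unfolding sum_triple_product cb mult_left_cancel[OF nz] by (rule refl)
  qed
  have "equiangular_tight_frame smul form a b c \<phi> \<longleftrightarrow> (\<forall>k j. ?G2 k j = c * form (\<phi> k) (\<phi> j))"
    using equi is_tight_frame_iff_gram[OF frame] by (simp add: equiangular_tight_frame_def)
  also have "\<dots> \<longleftrightarrow> ?diag \<and> ?triple"
  proof (intro iffI conjI allI impI)
    assume gram: "\<forall>k j. ?G2 k j = c * form (\<phi> k) (\<phi> j)"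
    \<comment> \<open>The diagonal condition mentions no index, so any single diagonal entry yields
      it.\<close>
    show ?diag
      using gram diag by blast
    show "(\<Sum>l\<in>UNIV. triple_product form (\<phi> j) (\<phi> k) (\<phi> l)) = c * b" if "j \<noteq> k" for j k
      using gram off[OF that] by blast
  next
    fix k j
    assume *: "?diag \<and> ?triple"
    show "?G2 k j = c * form (\<phi> k) (\<phi> j)"
    proof (cases "j = k")
      case True
      show ?thesis
        unfolding True using * diag[of k] by blast
    next
      case False
      then show ?thesis
        using * off[OF False] by blast
    qed
  qed
  finally show ?thesis .
qed

end

theorem theorem5p17:
  fixes smul :: "'f::field \<Rightarrow> 'v::ab_group_add \<Rightarrow> 'v"
    and \<sigma> :: "'f \<Rightarrow> 'f"
    and form :: "'v \<Rightarrow> 'v \<Rightarrow> 'f"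
    and \<phi> :: "'n::finite \<Rightarrow> 'v"
    and a b :: 'f
    and n d :: nat
  assumes "non_isotropic_space smul \<sigma> form"
    and "vector_space.dim smul (UNIV :: 'v set) = d"
    and "n = CARD('n)"
    and "a \<in> fixed_field \<sigma>" and "b \<in> fixed_field \<sigma>"
    and "equiangular form a b \<phi>"
    and "is_frame smul \<phi>"
    and "\<not> CHAR('f) dvd d"
    and "of_nat n * a / of_nat d \<noteq> 0"
  shows "equiangular_tight_frame smul form a b (of_nat n / of_nat d * a) \<phi> \<longleftrightarrow>
    (of_nat n - 1) * b = (of_nat n - of_nat d) / of_nat d * a\<^sup>2 \<and>
    (\<forall>j k. j \<noteq> k \<longrightarrow>
      (\<Sum>l\<in>UNIV. triple_product form (\<phi> j) (\<phi> k) (\<phi> l)) = of_nat n * a * b / of_nat d)"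
proof -
  interpret non_isotropic_space smul \<sigma> form
    by fact
  \<comment> \<open>Division by zero yields 0, so a nonzero quotient has a nonzero
    denominator.\<close>
  have d: "(of_nat d :: 'f) \<noteq> 0"
    using assms(9) by auto
  have "a\<^sup>2 + (of_nat n - 1) * b = of_nat n / of_nat d * a * a \<longleftrightarrow>
      (of_nat n - 1) * b = (of_nat n - of_nat d) / of_nat d * a\<^sup>2"
    using d by (simp add: field_simps power2_eq_square)
  then show ?thesis
    using equiangular_tight_frame_iff_triple_products[OF assms(6,7), of "of_nat n / of_nat d * a"]
    by (simp add: assms(3))
qed

end
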